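(* Let $\boldsymbol{\varphi}$ be the random roughness profile and $\boldsymbol{\alpha}\colon\Gamma_0\to\mathbb{R}$ the associated (random) slip amount on the smooth wall $\Gamma_0$. Suppose $\boldsymbol{\alpha}$ is uniformly bounded and Lipschitz, uniformly over realizations: there are known constants $C_\alpha,\gamma_1,\gamma_3>0$ with $$\boldsymbol{\alpha}(x)\le\gamma_1C_\alpha,\qquad|\boldsymbol{\alpha}(x)-\boldsymbol{\alpha}(y)|\le\frac{\gamma_1}{\gamma_3}C_\alpha|x-y|\qquad\text{for all }x,y\in\Gamma_0,$$ where $\lim_{\epsilon\to0}\epsilon/\gamma_1=\lim_{\epsilon\to0}\gamma_1/\gamma_3=0$. Assume that we have sample points $\{x_n\}_{n=1}^N$ in $\Gamma_0$ with $$\max_{z\in\Gamma_0}\min_{n=1,\dots,N}\|z-x_n\|\le|\Gamma_0|/N,$$ where $|\Gamma_0|$ is the length of $\Gamma_0$, and random variables $\{\tilde{\boldsymbol{\alpha}}_n\}_{n=1}^N$ estimating $\boldsymbol{\alpha}$ with $$\mathbb{E}\bigl[|\tilde{\boldsymbol{\alpha}}_n-\boldsymbol{\alpha}(x_n)|\bigr]\le\delta\gamma_2\quad\text{for some }\delta,\gamma_2>0\text{ and all }n=1,\dots,N.$$ Then for any interpolant $\tilde{\boldsymbol{\alpha}}(z)=\mathcal{I}\bigl[(\tilde{\boldsymbol{\alpha}}_n)_{n=1}^N\bigr](z)$, $z\in\Gamma_0$, such that $\mathcal{I}$ tightly interpolates $\boldsymbol{\alpha}$ to the first order, there exists $N$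 such that $$\mathbb{E}\left[\sup_{z\in\Gamma_0}|\tilde{\boldsymbol{\alpha}}(z)-\boldsymbol{\alpha}(z)|\right]\le2\gamma_1C\sqrt{|\Gamma_0|\,\delta\,\gamma_2/(\gamma_1\gamma_3)},$$ where $C>0$ depends only on $C_\alpha$ and on the interpolation constant $C_{\mathcal{I}}$.
   Context: Bold symbols denote random variables. The number of sample points $N$ is a free parameter: for each $N$ one has sample points, estimates and an interpolant as described, with $\delta,\gamma_2$ and the constants not depending on $N$. Geometry: $\epsilon>0$ is the roughness scale; $\gamma_1,\gamma_2,\gamma_3$ may depend on $\epsilon$. $\Gamma_0$ is the smooth wall, a part of the boundary of the smooth macroscopic domain $\Omega_0\subset\mathbb{R}^2$, with unit normal $n$. The rough wall is $\Gamma_\epsilon=\{x+\epsilon\boldsymbol{\varphi}(x_t/\epsilon)n(x)\mid x\in\Gamma_0\}$, where $\boldsymbol{\varphi}$ is a random $C^2$ function and $x_t$ denotes the tangential parameter of $x$ along $\Gamma_0$. Slip amount: for $x\in\Gamma_0$ one constructs a micro domain $Y_x$ with $\partial Y_x\cap\Gamma_\epsilon=\mathcal{B}_\epsilon(x)\cap\Gamma_\epsilon$, where $\mathcal{B}_\epsilon(x)$ is an $\epsilon$-sized ball around $x$. Let $h$ be the micro boundary data on $\partial Y_x$ (continuous, zero net flow through $\partial Y_x$, equal to the macroscopic velocity on $\Omega_0\cap\partial Y_x$ and equal to $0$ on $\Gamma_\epsilon\cap\partial Y_x$), let $\chi$ solve $-\Delta\chi+\nabla\pi=0$, $\nabla\cdot\chi=0$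 in $Y_x$, $\chi=h$ on $\partial Y_x$, and let $L\subset\Omega_0\cap Y_x$ be a straight line segment with unit tangent $t$ and unit normal $n$. Then $\boldsymbol{\alpha}(x)=-\langle\chi,t\rangle_L/\langle\partial_n\chi,t\rangle_L$, with $\langle\cdot,\cdot\rangle_L$ the $L^2$-inner product on $L$; equivalently $\boldsymbol{\alpha}(x)=-\langle h,r_1\rangle_{\partial Y_x}/\langle h,r_2\rangle_{\partial Y_x}$, where the Riesz representors $r_1,r_2$ on $\partial Y_x$ satisfy $\langle r_1,h\rangle_{\partial Y_x}=\langle\chi,t\rangle_L$ and $\langle r_2,h\rangle_{\partial Y_x}=\langle\partial_n\chi,t\rangle_L$ for all admissible $h$. Interpolant: for points $\{x_n\}_{n=1}^N\subset K$, an interpolant is a continuous linear operator $\mathcal{I}\colon\mathbb{R}^N\to C(K,\mathbb{R})$ with $\mathcal{I}[(\alpha_j)_{j=1}^N](x_n)=\alpha_n$ for all $n$ and with $\sup_{z\in K}|\mathcal{I}[(\alpha_j)_{j=1}^N](z)|\le C_{\mathcal{I}}\max_n|\alpha_n|$ for all $(\alpha_j)_{j=1}^N\in\mathbb{R}^N$. It tightly interpolates a Lipschitz function $\alpha\colon K\to\mathbb{R}$ with Lipschitz constant $L>0$ to the first order if $|\mathcal{I}[(\alpha(x_j))_{j=1}^N](z)-\alpha(z)|\le C_{\mathcal{I}}L\max_{w\in K}\min_n\|w-x_n\|$ for all $z\in K$, with $C_{\mathcal{I}}>0$ independent of $L$. Here $K=\Gamma_0$.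
   Formalization: The added condition δγ₂ ≤ (γ₁/γ₃)C_α|Γ₀| is assumed; without a bound of this form the claim fails, e.g. for estimates α(x_n)+δγ₂ with an interpolant reproducing constants, where the error is at least δγ₂ for every N. *)

theory Defs
  imports "HOL-Probability.Probability"
begin

section \<open>Differential operators in the plane\<close>

definition partial_deriv ::
  "'a::euclidean_space \<Rightarrow> ('a \<Rightarrow> 'b::real_normed_vector) \<Rightarrow> 'a \<Rightarrow> 'b" where
  "partial_deriv d f x = frechet_derivative f (at x) d"

text \<open>For an open set \<open>S\<close> this is the usual class of \<open>k\<close> times continuously differentiable
  functions on \<open>S\<close>; it is only used for open \<open>S\<close>.\<close>

primrec Ck_on :: "nat \<Rightarrow> ('a::euclidean_space \<Rightarrow> 'b::real_normed_vector) \<Rightarrow> 'a set \<Rightarrow> bool" where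
  "Ck_on 0 f S \<longleftrightarrow> continuous_on S f"
| "Ck_on (Suc k) f S \<longleftrightarrow>
     (\<forall>x\<in>S. f differentiable at x) \<and> (\<forall>d\<in>Basis. Ck_on k (partial_deriv d f) S)"

definition smooth_on :: "('a::euclidean_space \<Rightarrow> 'b::real_normed_vector) \<Rightarrow> 'a set \<Rightarrow> bool" where
  "smooth_on f S \<longleftrightarrow> (\<forall>k. Ck_on k f S)"

definition gradient :: "(real^2 \<Rightarrow> real) \<Rightarrow> real^2 \<Rightarrow> real^2" where
  "gradient p y = (\<chi> i. partial_deriv (axis i 1) p y)"

definition divergence :: "(real^2 \<Rightarrow> real^2) \<Rightarrow> real^2 \<Rightarrow> real" where
  "divergence v y = (\<Sum>i\<in>UNIV. partial_deriv (axis i 1) v y $ i)"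

definition laplacian :: "(real^2 \<Rightarrow> real^2) \<Rightarrow> real^2 \<Rightarrow> real^2" where
  "laplacian v y = (\<Sum>i\<in>UNIV. partial_deriv (axis i 1) (partial_deriv (axis i 1) v) y)"

definition rot90 :: "real^2 \<Rightarrow> real^2" where
  "rot90 v = (\<chi> i. if i = 1 then - (v $ 2) else v $ 1)"


section \<open>Smooth wall and rough wall\<close>

definition smooth_domain :: "(real^2) set \<Rightarrow> bool" where
  "smooth_domain \<Omega> \<longleftrightarrow> open \<Omega> \<and> connected \<Omega> \<and> \<Omega> \<noteq> {} \<and>
     (\<forall>p\<in>frontier \<Omega>. \<exists>U \<psi>. open U \<and> p \<in> U \<and> smooth_on \<psi> U \<and>
        (\<forall>y\<in>U. gradient \<psi> y \<noteq> 0) \<and> \<Omega> \<inter> U = {y\<in>U. \<psi> y < 0})"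

text \<open>The wall is the curve \<open>g ` {0..len}\<close>, parametrised by arc length. Hence \<open>len\<close> is the length of
  the wall, and the tangential parameter of the point \<open>g s\<close> is \<open>s\<close>. The curve may be closed. The
  unit normal field \<open>n\<close> is a function of the point; either orientation is admitted.\<close>

definition smooth_wall ::
  "(real^2) set \<Rightarrow> (real \<Rightarrow> real^2) \<Rightarrow> real \<Rightarrow> (real^2 \<Rightarrow> real^2) \<Rightarrow> bool" where
  "smooth_wall \<Omega>0 g len n \<longleftrightarrow>
     0 < len \<and> smooth_on g UNIV \<and> simple_path (\<lambda>u. g (len * u)) \<and>
     (\<forall>s\<in>{0..len}. norm (vector_derivative g (at s)) = 1) \<and>
     g ` {0..len} \<subseteq> frontier \<Omega>0 \<and>
     continuous_on (g ` {0..len}) n \<and>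
     (\<forall>s\<in>{0..len}. norm (n (g s)) = 1 \<and> n (g s) \<bullet> vector_derivative g (at s) = 0)"

definition random_profile :: "'w measure \<Rightarrow> ('w \<Rightarrow> real \<Rightarrow> real) \<Rightarrow> bool" where
  "random_profile M \<phi> \<longleftrightarrow>
     (\<forall>s. (\<lambda>\<omega>. \<phi> \<omega> s) \<in> borel_measurable M) \<and> (\<forall>\<omega>\<in>space M. Ck_on 2 (\<phi> \<omega>) UNIV)"

definition rough_wall ::
  "real \<Rightarrow> (real \<Rightarrow> real^2) \<Rightarrow> real \<Rightarrow> (real^2 \<Rightarrow> real^2) \<Rightarrow> (real \<Rightarrow> real) \<Rightarrow> (real^2) set" where
  "rough_wall \<epsilon> g len n \<phi> = (\<lambda>s. g s + (\<epsilon> * \<phi> (s / \<epsilon>)) *\<^sub>R n (g s)) ` {0..len}"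


section \<open>Micro problem and slip amount\<close>

text \<open>\<open>Y\<close> is the inside of the closed, piecewise continuously differentiable curve \<open>c\<close>; \<open>r\<close> is the
  radius of the ball around \<open>x\<close>, and \<open>W\<close> is the rough wall.\<close>

definition micro_domain ::
  "(real^2) set \<Rightarrow> real^2 \<Rightarrow> real \<Rightarrow> (real^2) set \<Rightarrow> (real \<Rightarrow> real^2) \<Rightarrow> bool" where
  "micro_domain W x r Y c \<longleftrightarrow>
     simple_path c \<and> pathfinish c = pathstart c \<and> c piecewise_C1_differentiable_on {0..1} \<and>
     Y = inside (path_image c) \<and> frontier Y = path_image c \<and>
     frontier Y \<inter> W = cball x r \<inter> W"

text \<open>The integral is the flow of \<open>h\<close> through the curve \<open>c\<close>, up to a sign given by the orientation
  of \<open>c\<close>. The function \<open>u\<close> is the macroscopic velocity.\<close>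

definition micro_data ::
  "(real^2) set \<Rightarrow> (real^2) set \<Rightarrow> (real^2 \<Rightarrow> real^2) \<Rightarrow> (real^2) set \<Rightarrow> (real \<Rightarrow> real^2)
     \<Rightarrow> (real^2 \<Rightarrow> real^2) \<Rightarrow> bool" where
  "micro_data \<Omega>0 W u Y c h \<longleftrightarrow>
     continuous_on (frontier Y) h \<and>
     ((\<lambda>s. h (c s) \<bullet> rot90 (vector_derivative c (at s))) has_integral 0) {0..1} \<and>
     (\<forall>y\<in>\<Omega>0 \<inter> frontier Y. h y = u y) \<and>
     (\<forall>y\<in>W \<inter> frontier Y. h y = 0)"

definition stokes_solution ::
  "(real^2) set \<Rightarrow> (real^2 \<Rightarrow> real^2) \<Rightarrow> (real^2 \<Rightarrow> real^2) \<Rightarrow> (real^2 \<Rightarrow> real) \<Rightarrow> bool" where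
  "stokes_solution Y h v p \<longleftrightarrow>
     Ck_on 2 v Y \<and> continuous_on (closure Y) v \<and> Ck_on 1 p Y \<and>
     (\<forall>y\<in>Y. - laplacian v y + gradient p y = 0) \<and>
     (\<forall>y\<in>Y. divergence v y = 0) \<and>
     (\<forall>y\<in>frontier Y. v y = h y)"

definition segment_inner ::
  "real^2 \<Rightarrow> real^2 \<Rightarrow> (real^2 \<Rightarrow> real^2) \<Rightarrow> (real^2 \<Rightarrow> real^2) \<Rightarrow> real" where
  "segment_inner A B f1 f2 = norm (B - A) *
     integral {0..1} (\<lambda>s. f1 (A + s *\<^sub>R (B - A)) \<bullet> f2 (A + s *\<^sub>R (B - A)))"

text \<open>\<open>a\<close> is the slip amount at \<open>x\<close> produced by some admissible choice of the micro domain, of the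
  micro boundary data and of the line segment from \<open>A\<close> to \<open>B\<close>, with unit tangent \<open>t\<close> and unit
  normal \<open>\<nu>\<close>. The denominator is required not to vanish, because division by zero is total here.\<close>

definition slip_amount ::
  "(real^2) set \<Rightarrow> (real^2) set \<Rightarrow> (real^2 \<Rightarrow> real^2) \<Rightarrow> real \<Rightarrow> real^2 \<Rightarrow> real \<Rightarrow> bool" where
  "slip_amount \<Omega>0 W u r x a \<longleftrightarrow>
     (\<exists>Y c h v p A B t \<nu>.
        micro_domain W x r Y c \<and> micro_data \<Omega>0 W u Y c h \<and> stokes_solution Y h v p \<and>
        A \<noteq> B \<and> closed_segment A B \<subseteq> \<Omega>0 \<inter> Y \<and>
        t = (B - A) /\<^sub>R norm (B - A) \<and> norm \<nu> = 1 \<and> \<nu> \<bullet> t = 0 \<and>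
        segment_inner A B (partial_deriv \<nu> v) (\<lambda>_. t) \<noteq> 0 \<and>
        a = - segment_inner A B v (\<lambda>_. t) / segment_inner A B (partial_deriv \<nu> v) (\<lambda>_. t))"


section \<open>Interpolants\<close>

text \<open>Vectors in \<open>\<real>\<^sup>N\<close> are functions \<open>nat \<Rightarrow> real\<close> of which only the values on \<open>{1..N}\<close> matter, and an
  element of \<open>C(K, \<real>)\<close> is a function of which only the values on \<open>K\<close> matter. The continuity of the
  operator \<open>I\<close> is the last bound.\<close>

definition interpolant ::
  "(real^2) set \<Rightarrow> nat \<Rightarrow> (nat \<Rightarrow> real^2) \<Rightarrow> real \<Rightarrow> ((nat \<Rightarrow> real) \<Rightarrow> real^2 \<Rightarrow> real) \<Rightarrow> bool" where
  "interpolant K N x CI I \<longleftrightarrow>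
     (\<forall>a b. (\<forall>n\<in>{1..N}. a n = b n) \<longrightarrow> (\<forall>z\<in>K. I a z = I b z)) \<and>
     (\<forall>a b. \<forall>z\<in>K. I (\<lambda>n. a n + b n) z = I a z + I b z) \<and>
     (\<forall>k a. \<forall>z\<in>K. I (\<lambda>n. k * a n) z = k * I a z) \<and>
     (\<forall>a. continuous_on K (I a)) \<and>
     (\<forall>a. \<forall>n\<in>{1..N}. I a (x n) = a n) \<and>
     (\<forall>a. (SUP z\<in>K. \<bar>I a z\<bar>) \<le> CI * Max ((\<lambda>n. \<bar>a n\<bar>) ` {1..N}))"

definition fill_distance :: "(real^2) set \<Rightarrow> nat \<Rightarrow> (nat \<Rightarrow> real^2) \<Rightarrow> real" where
  "fill_distance K N x = (SUP w\<in>K. Min ((\<lambda>n. norm (w - x n)) ` {1..N}))"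

definition tightly_interpolates ::
  "(real^2) set \<Rightarrow> nat \<Rightarrow> (nat \<Rightarrow> real^2) \<Rightarrow> real \<Rightarrow> ((nat \<Rightarrow> real) \<Rightarrow> real^2 \<Rightarrow> real)
     \<Rightarrow> real \<Rightarrow> (real^2 \<Rightarrow> real) \<Rightarrow> bool" where
  "tightly_interpolates K N x CI I L a \<longleftrightarrow>
     L > 0 \<and> L-lipschitz_on K a \<and>
     (\<forall>z\<in>K. \<bar>I (\<lambda>j. a (x j)) z - a z\<bar> \<le> CI * L * fill_distance K N x)"

end

theory Submission
  imports Defs
begin

text \<open>Write \<open>a = \<delta> \<gamma>\<^sub>2\<close> for the bound on the mean sampling error, \<open>L = \<gamma>\<^sub>1 C\<alpha> / \<gamma>\<^sub>3\<close> for the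
  Lipschitz constant of the slip amount and \<open>len\<close> for the length of the wall. By linearity of the
  interpolant the uniform error with \<open>N\<close> samples splits into the interpolant of the sampling errors
  and the interpolation error of the exact slip amount. The first is at most \<open>CI\<close> times the largest
  sampling error, whose mean is at most the sum of the \<open>N\<close> individual means, hence at most \<open>N a\<close>; the
  second is at most \<open>CI L len / N\<close>, because the samples fill the wall up to the distance
  \<open>len / N\<close>. The mean error is therefore at most \<open>CI (N a + L len / N)\<close>
  (\<open>expected_sup_error_le\<close>).

  The two contributions balance at \<open>N = sqrt (L len / a)\<close>, and both are then of the size
  \<open>sqrt (a L len) = \<gamma>\<^sub>1 sqrt C\<alpha> sqrt (len \<delta> \<gamma>\<^sub>2 / (\<gamma>\<^sub>1 \<gamma>\<^sub>3))\<close>, which is the claimed rate. The balancing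
  value is at least \<open>1\<close> because \<open>a \<le> L len\<close>, so that rounding it down to an integer loses at most a
  factor of two (\<open>balancing_sample_number\<close>). This gives the constant \<open>C = 3/2 CI sqrt C\<alpha>\<close>.

  That the uniform error is a random variable at all rests on two facts: the interpolant is a finite
  linear combination of the samples (\<open>interpolant_eq_sum\<close>), so that the error at each single point is
  measurable, and by continuity the supremum may be taken over a countable dense set of points
  (\<open>borel_measurable_SUP_compact\<close>).\<close>

section \<open>Suprema of continuous random functions\<close>

text \<open>A continuous function on \<open>K\<close> has the same supremum over \<open>K\<close> as over a countable dense subset,
  and countable suprema preserve measurability.\<close>

lemma borel_measurable_SUP_compact:
  fixes f :: "'w \<Rightarrow> 'a::{metric_space, second_countable_topology} \<Rightarrow> real"
  assumes K: "compact K" "K \<noteq> {}"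
    and cont: "\<And>\<omega>. \<omega> \<in> space M \<Longrightarrow> continuous_on K (f \<omega>)"
    and meas: "\<And>z. z \<in> K \<Longrightarrow> (\<lambda>\<omega>. f \<omega> z) \<in> borel_measurable M"
  shows "(\<lambda>\<omega>. SUP z\<in>K. f \<omega> z) \<in> borel_measurable M"
proof -
  obtain D where D: "countable D" "D \<subseteq> K" "K \<subseteq> closure D"
    using separable[of K] by blast
  have closure_D: "closure D = K"
    using D closure_minimal[OF D(2) compact_imp_closed[OF K(1)]] by auto
  have D_ne: "D \<noteq> {}" using D K by auto
  have bdd_K: "bdd_above (f \<omega> ` K)" if "\<omega> \<in> space M" for \<omega>
    using compact_continuous_image[OF cont[OF that] K(1)]
    by (simp add: bounded_imp_bdd_above compact_imp_bounded)
  have bdd_D: "bdd_above (f \<omega> ` D)" if "\<omega> \<in> space M" for \<omega>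
    using bdd_K[OF that] D(2) by (meson bdd_above_mono image_mono)
  have SUP_eq: "(SUP z\<in>K. f \<omega> z) = (SUP z\<in>D. f \<omega> z)" if \<omega>: "\<omega> \<in> space M" for \<omega>
  proof (rule antisym)
    show "(SUP z\<in>K. f \<omega> z) \<le> (SUP z\<in>D. f \<omega> z)"
    proof (rule cSUP_least[OF K(2)])
      fix z assume "z \<in> K"
      then show "f \<omega> z \<le> (SUP z\<in>D. f \<omega> z)"
        using continuous_le_on_closure[of D "f \<omega>" z "SUP z\<in>D. f \<omega> z"]
          cont[OF \<omega>] closure_D bdd_D[OF \<omega>] by (auto intro: cSUP_upper)
    qed
    show "(SUP z\<in>D. f \<omega> z) \<le> (SUP z\<in>K. f \<omega> z)"
      using D_ne bdd_K[OF \<omega>] D(2) by (intro cSUP_subset_mono) auto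
  qed
  have "(\<lambda>\<omega>. SUP z\<in>D. f \<omega> z) \<in> borel_measurable M"
    by (intro borel_measurable_cSUP D(1) meas bdd_D) (use D(2) in auto)
  then show ?thesis
    using SUP_eq by (simp cong: measurable_cong)
qed

section \<open>Interpolation of perturbed samples\<close>

lemma interpolantD:
  assumes "interpolant K N x CI I" "z \<in> K"
  shows interpolant_cong: "(\<And>n. n \<in> {1..N} \<Longrightarrow> a n = b n) \<Longrightarrow> I a z = I b z"
    and interpolant_add: "I (\<lambda>n. a n + b n) z = I a z + I b z"
    and interpolant_scale: "I (\<lambda>n. r * a n) z = r * I a z"
  using assms by (simp_all add: interpolant_def)

lemma interpolant_eq_sum:
  assumes I: "interpolant K N x CI I" and z: "z \<in> K"
  shows "I a z = (\<Sum>k\<in>{1..N}. a k * I (\<lambda>n. if n = k then 1 else 0) z)"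
proof -
  define e where "e k = (\<lambda>n. if n = k then 1 else 0 :: real)" for k :: nat
  note add = interpolant_add[OF I z] and scale = interpolant_scale[OF I z]
  have "I (\<lambda>n. \<Sum>k\<in>S. a k * e k n) z = (\<Sum>k\<in>S. a k * I (e k) z)" if "finite S" for S
    using that
  proof induction
    case empty
    show ?case using scale[of 0 a] by simp
  next
    case (insert k S)
    then show ?case
      using add[of "\<lambda>n. a k * e k n" "\<lambda>n. \<Sum>k\<in>S. a k * e k n"] scale[of "a k" "e k"] by simp
  qed
  from this[of "{1..N}"] have "I (\<lambda>n. \<Sum>k\<in>{1..N}. a k * e k n) z = (\<Sum>k\<in>{1..N}. a k * I (e k) z)"
    by simp
  moreover have "I a z = I (\<lambda>n. \<Sum>k\<in>{1..N}. a k * e k n) z"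
    by (rule interpolant_cong[OF I z]) (auto simp: e_def if_distrib cong: if_cong)
  ultimately show ?thesis by (simp add: e_def)
qed

lemma interpolant_abs_le_sum:
  assumes I: "interpolant K N x CI I" and K: "compact K" and z: "z \<in> K"
    and "CI \<ge> 0" "N \<ge> 1"
  shows "\<bar>I a z\<bar> \<le> CI * (\<Sum>k\<in>{1..N}. \<bar>a k\<bar>)"
proof -
  have "continuous_on K (\<lambda>z. \<bar>I a z\<bar>)"
    using I by (auto simp: interpolant_def intro!: continuous_intros)
  then have "bdd_above ((\<lambda>z. \<bar>I a z\<bar>) ` K)"
    using K by (simp add: bounded_imp_bdd_above compact_continuous_image compact_imp_bounded)
  then have "\<bar>I a z\<bar> \<le> (SUP z\<in>K. \<bar>I a z\<bar>)"
    using z by (intro cSUP_upper) auto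
  also have "\<dots> \<le> CI * Max ((\<lambda>k. \<bar>a k\<bar>) ` {1..N})"
    using I by (auto simp: interpolant_def)
  also have "\<dots> \<le> CI * (\<Sum>k\<in>{1..N}. \<bar>a k\<bar>)"
  proof (rule mult_left_mono[OF _ \<open>CI \<ge> 0\<close>])
    show "Max ((\<lambda>k. \<bar>a k\<bar>) ` {1..N}) \<le> (\<Sum>k\<in>{1..N}. \<bar>a k\<bar>)"
      using \<open>N \<ge> 1\<close> by (subst Max_le_iff) (auto intro!: member_le_sum)
  qed
  finally show ?thesis .
qed

text \<open>Linearity splits the error into the interpolated perturbation of the samples and the
  interpolation error of the exact function.\<close>

lemma perturbed_interpolation_error_le:
  assumes I: "interpolant K N x CI I" and tight: "tightly_interpolates K N x CI I L f"
    and K: "compact K" and z: "z \<in> K" and "CI \<ge> 0" "N \<ge> 1"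
  shows "\<bar>I b z - f z\<bar> \<le>
    CI * ((\<Sum>k\<in>{1..N}. \<bar>b k - f (x k)\<bar>) + L * fill_distance K N x)"
proof -
  have "I (\<lambda>k. (b k - f (x k)) + f (x k)) z = I (\<lambda>k. b k - f (x k)) z + I (\<lambda>k. f (x k)) z"
    by (rule interpolant_add[OF I z])
  then have "I b z - f z = I (\<lambda>k. b k - f (x k)) z + (I (\<lambda>k. f (x k)) z - f z)"
    by simp
  moreover have "\<bar>I (\<lambda>k. b k - f (x k)) z\<bar> \<le> CI * (\<Sum>k\<in>{1..N}. \<bar>b k - f (x k)\<bar>)"
    by (rule interpolant_abs_le_sum[OF I K z \<open>CI \<ge> 0\<close> \<open>N \<ge> 1\<close>])
  moreover have "\<bar>I (\<lambda>k. f (x k)) z - f z\<bar> \<le> CI * L * fill_distance K N x"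
    using tight z by (auto simp: tightly_interpolates_def)
  ultimately show ?thesis by (simp add: algebra_simps)
qed

section \<open>The expected uniform error\<close>

text \<open>The sampling errors may depend on each other in any way. Only their individual means are
  controlled, so their maximum is estimated by their sum; this is the source of the factor \<open>N\<close>.
  The same sum gives the integrable bound on the supremum.\<close>

lemma expected_sup_error_le:
  fixes f :: "'w \<Rightarrow> real^2 \<Rightarrow> real" and b :: "nat \<Rightarrow> 'w \<Rightarrow> real"
  assumes M: "prob_space M" and K: "compact K" "K \<noteq> {}" and "CI \<ge> 0" "L \<ge> 0" "N \<ge> 1"
    and I: "interpolant K N x CI I"
    and tight: "\<And>\<omega>. \<omega> \<in> space M \<Longrightarrow> tightly_interpolates K N x CI I L (f \<omega>)"
    and f_meas: "\<And>z. z \<in> K \<Longrightarrow> (\<lambda>\<omega>. f \<omega> z) \<in> borel_measurable M"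
    and b_meas: "\<And>k. k \<in> {1..N} \<Longrightarrow> b k \<in> borel_measurable M"
    and err_int: "\<And>k. k \<in> {1..N} \<Longrightarrow> integrable M (\<lambda>\<omega>. \<bar>b k \<omega> - f \<omega> (x k)\<bar>)"
    and err_le: "\<And>k. k \<in> {1..N} \<Longrightarrow> prob_space.expectation M (\<lambda>\<omega>. \<bar>b k \<omega> - f \<omega> (x k)\<bar>) \<le> a"
    and fill: "fill_distance K N x \<le> d"
  shows "integrable M (\<lambda>\<omega>. SUP z\<in>K. \<bar>I (\<lambda>k. b k \<omega>) z - f \<omega> z\<bar>)"
    and "prob_space.expectation M (\<lambda>\<omega>. SUP z\<in>K. \<bar>I (\<lambda>k. b k \<omega>) z - f \<omega> z\<bar>)
      \<le> CI * (real N * a + L * d)"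
proof -
  interpret prob_space M by (rule M)
  let ?err = "\<lambda>\<omega> z. \<bar>I (\<lambda>k. b k \<omega>) z - f \<omega> z\<bar>"
  define B where "B \<omega> = CI * ((\<Sum>k\<in>{1..N}. \<bar>b k \<omega> - f \<omega> (x k)\<bar>) + L * d)" for \<omega>
  have err_le_B: "?err \<omega> z \<le> B \<omega>" if "\<omega> \<in> space M" "z \<in> K" for \<omega> z
  proof -
    have "?err \<omega> z \<le>
        CI * ((\<Sum>k\<in>{1..N}. \<bar>b k \<omega> - f \<omega> (x k)\<bar>) + L * fill_distance K N x)"
      by (rule perturbed_interpolation_error_le)
        (use I tight K that \<open>CI \<ge> 0\<close> \<open>N \<ge> 1\<close> in auto)
    also have "\<dots> \<le> B \<omega>"
      unfolding B_def using fill \<open>CI \<ge> 0\<close> \<open>L \<ge> 0\<close> by (intro mult_left_mono add_left_mono) auto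
    finally show ?thesis .
  qed
  have SUP_le_B: "(SUP z\<in>K. ?err \<omega> z) \<le> B \<omega>" if "\<omega> \<in> space M" for \<omega>
    using err_le_B[OF that] K by (intro cSUP_least) auto
  have SUP_nonneg: "0 \<le> (SUP z\<in>K. ?err \<omega> z)" if \<omega>: "\<omega> \<in> space M" for \<omega>
  proof -
    obtain z where "z \<in> K" using K by auto
    have "bdd_above (?err \<omega> ` K)"
      using err_le_B[OF \<omega>] by (intro bdd_aboveI2[where M = "B \<omega>"]) auto
    then show ?thesis
      using cSUP_upper2[of "?err \<omega>" K z 0] \<open>z \<in> K\<close> by auto
  qed
  have B_int: "integrable M B"
    unfolding B_def using err_int
    by (intro integrable_mult_right Bochner_Integration.integrable_add
        Bochner_Integration.integrable_sum) auto
  have SUP_meas: "(\<lambda>\<omega>. SUP z\<in>K. ?err \<omega> z) \<in> borel_measurable M"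
  proof (rule borel_measurable_SUP_compact[OF K])
    fix \<omega> assume "\<omega> \<in> space M"
    then have "continuous_on K (f \<omega>)"
      using tight by (auto simp: tightly_interpolates_def intro: lipschitz_on_continuous_on)
    moreover have "continuous_on K (I (\<lambda>k. b k \<omega>))"
      using I by (auto simp: interpolant_def)
    ultimately show "continuous_on K (?err \<omega>)" by (intro continuous_intros)
  next
    fix z assume z: "z \<in> K"
    have "(\<lambda>\<omega>. I (\<lambda>k. b k \<omega>) z) \<in> borel_measurable M"
      unfolding interpolant_eq_sum[OF I z, of "\<lambda>k. b k _"]
      using b_meas by (intro borel_measurable_sum borel_measurable_times) auto
    then show "(\<lambda>\<omega>. ?err \<omega> z) \<in> borel_measurable M"
      using f_meas[OF z] by measurable
  qed
  show SUP_int: "integrable M (\<lambda>\<omega>. SUP z\<in>K. ?err \<omega> z)"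
  proof (rule Bochner_Integration.integrable_bound[OF B_int SUP_meas], rule AE_I2)
    fix \<omega> assume "\<omega> \<in> space M"
    then show "norm (SUP z\<in>K. ?err \<omega> z) \<le> norm (B \<omega>)"
      using SUP_le_B SUP_nonneg by fastforce
  qed
  have "expectation (\<lambda>\<omega>. SUP z\<in>K. ?err \<omega> z) \<le> expectation B"
    using SUP_le_B by (intro integral_mono SUP_int B_int) auto
  also have "\<dots> = CI * ((\<Sum>k\<in>{1..N}. expectation (\<lambda>\<omega>. \<bar>b k \<omega> - f \<omega> (x k)\<bar>)) + L * d)"
  proof -
    have "expectation (\<lambda>\<omega>. (\<Sum>k\<in>{1..N}. \<bar>b k \<omega> - f \<omega> (x k)\<bar>) + L * d) =
        expectation (\<lambda>\<omega>. \<Sum>k\<in>{1..N}. \<bar>b k \<omega> - f \<omega> (x k)\<bar>) + expectation (\<lambda>_. L * d)"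
      using err_int
      by (intro Bochner_Integration.integral_add Bochner_Integration.integrable_sum) auto
    moreover have "expectation (\<lambda>\<omega>. \<Sum>k\<in>{1..N}. \<bar>b k \<omega> - f \<omega> (x k)\<bar>) =
        (\<Sum>k\<in>{1..N}. expectation (\<lambda>\<omega>. \<bar>b k \<omega> - f \<omega> (x k)\<bar>))"
      using err_int by (intro Bochner_Integration.integral_sum)
    ultimately show ?thesis by (simp add: B_def[abs_def] prob_space)
  qed
  also have "\<dots> \<le> CI * (real N * a + L * d)"
    using sum_mono[of "{1..N}", OF err_le] \<open>CI \<ge> 0\<close> by (intro mult_left_mono) auto
  finally show "expectation (\<lambda>\<omega>. SUP z\<in>K. ?err \<omega> z) \<le> CI * (real N * a + L * d)" .
qed

text \<open>The real minimiser \<open>sqrt (B / a)\<close> of \<open>N a + B / N\<close> would give \<open>2 sqrt (a B)\<close>. Rounding it down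
  does not increase the first term and, as it is at least \<open>1\<close>, at most doubles the second.\<close>

lemma balancing_sample_number:
  fixes a B :: real
  assumes "0 < a" "a \<le> B"
  obtains N :: nat where "N \<ge> 1" "real N * a + B / real N \<le> 3 * sqrt (a * B)"
proof
  define s where "s = sqrt (B / a)"
  define N where "N = nat \<lfloor>s\<rfloor>"
  have "s \<ge> 1" using assms by (simp add: s_def)
  then show "N \<ge> 1" by (simp add: N_def le_nat_floor)
  have N: "real N \<le> s" "s \<le> 2 * real N"
  proof -
    have "\<lfloor>s\<rfloor> \<ge> 1" using \<open>s \<ge> 1\<close> by simp
    moreover have "real N = real_of_int \<lfloor>s\<rfloor>" using calculation by (simp add: N_def)
    ultimately show "real N \<le> s" "s \<le> 2 * real N" by linarith+
  qed
  have sa: "s * a = sqrt (a * B)" and s_sqrt: "s * sqrt (a * B) = B"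
    using assms by (simp_all add: s_def real_sqrt_mult real_sqrt_divide field_simps)
  have "real N * a \<le> sqrt (a * B)"
    using N(1) \<open>0 < a\<close> by (simp flip: sa)
  moreover have "B \<le> 2 * real N * sqrt (a * B)"
    using mult_right_mono[OF N(2), of "sqrt (a * B)"] s_sqrt assms by simp
  then have "B / real N \<le> 2 * sqrt (a * B)"
    using \<open>N \<ge> 1\<close> by (simp add: divide_simps mult_ac)
  ultimately show "real N * a + B / real N \<le> 3 * sqrt (a * B)" by simp
qed

lemma smooth_wall_compact:
  assumes "smooth_wall \<Omega> g len n"
  shows "compact (g ` {0..len})"
proof -
  have "Ck_on 0 g UNIV"
    using assms unfolding smooth_wall_def smooth_on_def by blast
  then have "continuous_on {0..len} g"
    using continuous_on_subset by auto
  then show ?thesis by (rule compact_continuous_image) simp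
qed

section \<open>The error bound for the slip amount\<close>

theorem theorem5p6:
  fixes C\<alpha> CI :: real
  assumes "C\<alpha> > 0" and "CI > 0"
  shows "\<exists>C>0.
    \<forall>(M :: 'w measure) (\<Omega>0 :: (real^2) set) (g :: real \<Rightarrow> real^2) (len :: real)
     (n :: real^2 \<Rightarrow> real^2) (\<Gamma>0 :: (real^2) set) (\<phi> :: 'w \<Rightarrow> real \<Rightarrow> real)
     (\<gamma>1 :: real \<Rightarrow> real) (\<gamma>2 :: real \<Rightarrow> real) (\<gamma>3 :: real \<Rightarrow> real) (\<delta> :: real)
     (\<epsilon> :: real) (\<rho> :: real) (u :: 'w \<Rightarrow> real^2 \<Rightarrow> real^2) (\<alpha> :: 'w \<Rightarrow> real^2 \<Rightarrow> real)
     (x :: nat \<Rightarrow> nat \<Rightarrow> real^2) (\<alpha>t :: nat \<Rightarrow> nat \<Rightarrow> 'w \<Rightarrow> real)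
     (I :: nat \<Rightarrow> (nat \<Rightarrow> real) \<Rightarrow> real^2 \<Rightarrow> real).
      prob_space M \<longrightarrow>
      smooth_domain \<Omega>0 \<longrightarrow> smooth_wall \<Omega>0 g len n \<longrightarrow> \<Gamma>0 = g ` {0..len} \<longrightarrow>
      random_profile M \<phi> \<longrightarrow>
      (\<forall>e>0. \<gamma>1 e > 0 \<and> \<gamma>2 e > 0 \<and> \<gamma>3 e > 0) \<longrightarrow>
      ((\<lambda>e. e / \<gamma>1 e) \<longlongrightarrow> 0) (at_right 0) \<longrightarrow>
      ((\<lambda>e. \<gamma>1 e / \<gamma>3 e) \<longlongrightarrow> 0) (at_right 0) \<longrightarrow>
      \<epsilon> > 0 \<longrightarrow> \<rho> > 0 \<longrightarrow> \<delta> > 0 \<longrightarrow>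
      (\<forall>\<omega>\<in>space M. continuous_on \<Omega>0 (u \<omega>)) \<longrightarrow>
      (\<forall>z\<in>\<Gamma>0. (\<lambda>\<omega>. \<alpha> \<omega> z) \<in> borel_measurable M) \<longrightarrow>
      (\<forall>\<omega>\<in>space M. \<forall>z\<in>\<Gamma>0.
         slip_amount \<Omega>0 (rough_wall \<epsilon> g len n (\<phi> \<omega>)) (u \<omega>) (\<rho> * \<epsilon>) z (\<alpha> \<omega> z)) \<longrightarrow>
      (\<forall>\<omega>\<in>space M. \<forall>z\<in>\<Gamma>0. \<alpha> \<omega> z \<le> \<gamma>1 \<epsilon> * C\<alpha>) \<longrightarrow>
      (\<forall>\<omega>\<in>space M. \<forall>y\<in>\<Gamma>0. \<forall>z\<in>\<Gamma>0.
         \<bar>\<alpha> \<omega> y - \<alpha> \<omega> z\<bar> \<le> \<gamma>1 \<epsilon> / \<gamma>3 \<epsilon> * C\<alpha> * norm (y - z)) \<longrightarrow>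
      (\<forall>N\<ge>1. (\<forall>k\<in>{1..N}. x N k \<in> \<Gamma>0) \<and> fill_distance \<Gamma>0 N (x N) \<le> len / real N) \<longrightarrow>
      (\<forall>N\<ge>1. \<forall>k\<in>{1..N}. \<alpha>t N k \<in> borel_measurable M \<and>
         integrable M (\<lambda>\<omega>. \<bar>\<alpha>t N k \<omega> - \<alpha> \<omega> (x N k)\<bar>) \<and>
         prob_space.expectation M (\<lambda>\<omega>. \<bar>\<alpha>t N k \<omega> - \<alpha> \<omega> (x N k)\<bar>) \<le> \<delta> * \<gamma>2 \<epsilon>) \<longrightarrow>
      \<delta> * \<gamma>2 \<epsilon> \<le> \<gamma>1 \<epsilon> / \<gamma>3 \<epsilon> * C\<alpha> * len \<longrightarrow>
      (\<forall>N\<ge>1. interpolant \<Gamma>0 N (x N) CI (I N) \<and>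
         (\<forall>\<omega>\<in>space M.
            tightly_interpolates \<Gamma>0 N (x N) CI (I N) (\<gamma>1 \<epsilon> / \<gamma>3 \<epsilon> * C\<alpha>) (\<alpha> \<omega>))) \<longrightarrow>
      (\<exists>N\<ge>1.
         integrable M (\<lambda>\<omega>. SUP z\<in>\<Gamma>0. \<bar>I N (\<lambda>k. \<alpha>t N k \<omega>) z - \<alpha> \<omega> z\<bar>) \<and>
         prob_space.expectation M (\<lambda>\<omega>. SUP z\<in>\<Gamma>0. \<bar>I N (\<lambda>k. \<alpha>t N k \<omega>) z - \<alpha> \<omega> z\<bar>)
           \<le> 2 * \<gamma>1 \<epsilon> * C * sqrt (len * \<delta> * \<gamma>2 \<epsilon> / (\<gamma>1 \<epsilon> * \<gamma>3 \<epsilon>)))"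
  \<comment> \<open>The factor \<open>3 / 2\<close> turns the constant \<open>3\<close> of the rounded balance into the \<open>2\<close> of the claim;
    \<open>sqrt C\<alpha>\<close> is the square root of the factor \<open>C\<alpha>\<close> in the Lipschitz constant.\<close>
proof (intro exI[of _ "3 / 2 * CI * sqrt C\<alpha>"] conjI allI impI, goal_cases)
  case 1
  show ?case using assms by simp
next
  case (2 M \<Omega>0 g len n \<Gamma>0 \<phi> \<gamma>1 \<gamma>2 \<gamma>3 \<delta> \<epsilon> \<rho> u \<alpha> x \<alpha>t I)
  note \<Gamma>0 = 2(4) and samples = 2(17) and estimates = 2(18) and interp = 2(20)
  \<comment> \<open>The number in \<open>2(i)\<close> counts the hypotheses of the implication chain in the order stated.\<close>
  define L a where "L = \<gamma>1 \<epsilon> / \<gamma>3 \<epsilon> * C\<alpha>" and "a = \<delta> * \<gamma>2 \<epsilon>"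
  have pos: "\<gamma>1 \<epsilon> > 0" "\<gamma>2 \<epsilon> > 0" "\<gamma>3 \<epsilon> > 0" using 2(6,9) by auto
  have "len > 0" using 2(3) by (simp add: smooth_wall_def)
  have "L > 0" "a > 0" "a \<le> L * len"
    using pos assms 2(11,19) by (simp_all add: L_def a_def)
  then obtain N where N: "N \<ge> 1" "real N * a + L * len / real N \<le> 3 * sqrt (a * (L * len))"
    using balancing_sample_number by metis
  have K: "compact \<Gamma>0" "\<Gamma>0 \<noteq> {}"
    using smooth_wall_compact[OF 2(3)] \<open>len > 0\<close> by (auto simp: \<Gamma>0)
  have error: "integrable M (\<lambda>\<omega>. SUP z\<in>\<Gamma>0. \<bar>I N (\<lambda>k. \<alpha>t N k \<omega>) z - \<alpha> \<omega> z\<bar>)"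
    "prob_space.expectation M (\<lambda>\<omega>. SUP z\<in>\<Gamma>0. \<bar>I N (\<lambda>k. \<alpha>t N k \<omega>) z - \<alpha> \<omega> z\<bar>)
      \<le> CI * (real N * a + L * (len / real N))"
    using expected_sup_error_le[OF 2(1) K less_imp_le[OF \<open>CI > 0\<close>] less_imp_le[OF \<open>L > 0\<close>] N(1),
        where f = \<alpha> and I = "I N" and b = "\<alpha>t N" and x = "x N" and a = a and d = "len / real N"]
      2(13) N(1) samples estimates interp
    unfolding L_def a_def by blast+
  have rate: "sqrt (a * (L * len)) =
      \<gamma>1 \<epsilon> * sqrt C\<alpha> * sqrt (len * \<delta> * \<gamma>2 \<epsilon> / (\<gamma>1 \<epsilon> * \<gamma>3 \<epsilon>))"
  proof -
    have "a * (L * len) = (\<gamma>1 \<epsilon>)\<^sup>2 * C\<alpha> * (len * \<delta> * \<gamma>2 \<epsilon> / (\<gamma>1 \<epsilon> * \<gamma>3 \<epsilon>))"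
      using pos by (simp add: a_def L_def field_simps power2_eq_square)
    then show ?thesis by (simp only: real_sqrt_mult real_sqrt_abs abs_of_pos[OF pos(1)])
  qed
  have "CI * (real N * a + L * (len / real N)) \<le> CI * (3 * sqrt (a * (L * len)))"
    using N(2) assms by (intro mult_left_mono) auto
  also have "\<dots> = 2 * \<gamma>1 \<epsilon> * (3 / 2 * CI * sqrt C\<alpha>) *
      sqrt (len * \<delta> * \<gamma>2 \<epsilon> / (\<gamma>1 \<epsilon> * \<gamma>3 \<epsilon>))"
    by (simp only: rate) simp
  finally show ?case using N(1) error by (intro exI[of _ N]) auto
qed

end
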